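(* Let $n\ge1$. Let $\mathsf C'(n)=(\mathsf c_{j+k+1})_{0\le j,k<n}$ be the shifted Catalan Hankel matrix and $\mathsf S'(n)=(\mathsf c'_{j,k})_{0\le j,k<n}$ the lower-triangular matrix of shifted semi-Catalan numbers. For $0\le j,k<n$, $$\bigl(\mathsf S'(n)^{-1}\bigr)_{j,k}=(-1)^{j+k}\binom{j+k+1}{j-k},$$ $$\bigl(\mathsf C'(n)^{-1}\bigr)_{j,k}=(-1)^{j+k}\sum_{i=\max\{j,k\}}^{n-1}\binom{i+j+1}{i-j}\binom{i+k+1}{i-k}.$$
   Context: $\mathsf c_p=\binom{2p}{p}-\binom{2p}{p+1}$ are the Catalan numbers. The shifted semi-Catalan numbers are $\mathsf c'_{p,q}=\frac{q+1}{p+1}\binom{2p+2}{p-q}$. Binomial coefficients $\binom{p}{q}$ with $q<0$ are $0$. *)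

theory Defs
  imports "Jordan_Normal_Form.Gauss_Jordan_Elimination"
begin

text \<open>Binomial coefficients with an integer lower index, which vanish when that index is
  negative; truncated subtraction on \<^typ>\<open>nat\<close> would give the value 1 instead.\<close>

definition binom :: "nat \<Rightarrow> int \<Rightarrow> rat" where
  "binom p q = (if q < 0 then 0 else of_nat (p choose nat q))"

definition catalan :: "nat \<Rightarrow> rat" where
  "catalan p = binom (2 * p) (int p) - binom (2 * p) (int p + 1)"

definition shifted_semi_catalan :: "nat \<Rightarrow> nat \<Rightarrow> rat" where
  "shifted_semi_catalan p q =
     (of_nat q + 1) / (of_nat p + 1) * binom (2 * p + 2) (int p - int q)"

text \<open>The matrices have integer entries but are taken over the field of rationals, since
  \<^const>\<open>mat_inverse\<close> needs a field.\<close>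

definition shifted_catalan_mat :: "nat \<Rightarrow> rat mat" where
  "shifted_catalan_mat n = mat n n (\<lambda>(j, k). catalan (j + k + 1))"

definition shifted_semi_catalan_mat :: "nat \<Rightarrow> rat mat" where
  "shifted_semi_catalan_mat n = mat n n (\<lambda>(j, k). shifted_semi_catalan j k)"

end

theory Submission
  imports Defs "Jordan_Normal_Form.Determinant"
begin

text \<open>
  Let \<open>A\<close> be the infinite symmetric tridiagonal matrix with 2 on the diagonal and 1 next to it.
  Everything follows from the fact that row \<open>p\<close> of the shifted semi-Catalan triangle is
  \<open>A\<^sup>p e\<^sub>0\<close> (lemmas \<open>shifted_semi_catalan_0\<close>, \<open>shifted_semi_catalan_Suc_0\<close> and
  \<open>shifted_semi_catalan_Suc_Suc\<close>); this is Pascal's rule applied twice to the ballot form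
  \<open>binom (2p+1) (p-q) - binom (2p+1) (p-q-1)\<close> of its entries.

  The Hankel matrix: since \<open>A\<close> is symmetric, the inner product of \<open>A\<^sup>j e\<^sub>0\<close> and \<open>A\<^sup>k e\<^sub>0\<close> equals
  that of \<open>A\<^bsup>j+k\<^esup> e\<^sub>0\<close> and \<open>e\<^sub>0\<close>, which is the Catalan number with index \<open>j+k+1\<close>. Hence the
  shifted Catalan Hankel matrix is \<open>S S\<^sup>T\<close>, where \<open>S\<close> is the semi-Catalan matrix
  (lemma \<open>sum_shifted_semi_catalan_mult\<close>).

  The triangular matrix: the entries \<open>(-1)\<^bsup>j+k\<^esup> binom (j+k+1) (j-k)\<close> are the coefficients of the
  polynomials \<open>P\<^sub>j\<close> with \<open>P\<^sub>0 = 1\<close>, \<open>P\<^sub>1 = x - 2\<close> and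
  \<open>P\<^bsub>j+2\<^esub> = (x - 2) P\<^bsub>j+1\<^esub> - P\<^sub>j\<close>, that is, of \<open>U\<^sub>j (x/2 - 1)\<close> with \<open>U\<^sub>j\<close> the Chebyshev
  polynomials of the second kind. As \<open>(A - 2) e\<^sub>i = e\<^bsub>i-1\<^esub> + e\<^bsub>i+1\<^esub>\<close> with \<open>e\<^bsub>-1\<^esub> = 0\<close>, these satisfy
  \<open>P\<^sub>j(A) e\<^sub>0 = e\<^sub>j\<close>, which says that the matrix of coefficients is a left inverse of \<open>S\<close>
  (lemma \<open>sum_chebyshev_coeff_mult\<close>). The inverse of \<open>S S\<^sup>T\<close> is then \<open>B\<^sup>T B\<close> with
  \<open>B = S\<^sup>-\<^sup>1\<close>.
\<close>

section \<open>Binomial coefficients with integer lower index\<close>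

lemma binom_neg: "q < 0 \<Longrightarrow> binom p q = 0"
  by (simp add: binom_def)

lemma binom_of_nat: "binom p (int q) = of_nat (p choose q)"
  by (simp add: binom_def)

lemma binom_zero_right [simp]: "binom p 0 = 1"
  by (simp add: binom_def)

lemma binom_Suc: "binom (Suc p) q = binom p q + binom p (q - 1)"
proof (cases "q \<le> 0")
  case True
  then show ?thesis by (auto simp: binom_def)
next
  case False
  then obtain r where "q = int (Suc r)"
    by (metis not_le gr0_implies_Suc zero_less_imp_eq_int)
  then show ?thesis by (simp add: binom_def nat_add_distrib)
qed

lemma binom_Suc_Suc:
  "binom (Suc (Suc p)) q = binom p q + 2 * binom p (q - 1) + binom p (q - 2)"
  by (simp add: binom_Suc)

lemma binom_symmetric: "binom p (int p - q) = binom p q"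
proof -
  consider "q < 0" | "q > int p" | "0 \<le> q" "q \<le> int p" by linarith
  then show ?thesis
  proof cases
    case 3
    then obtain r where r: "q = int r" "r \<le> p" by (metis nonneg_int_cases of_nat_le_iff)
    have "int p - q = int (p - r)" using r by simp
    then show ?thesis using r by (simp only: binom_of_nat binomial_symmetric[of r p])
  qed (auto simp: binom_def)
qed

lemma binom_absorption:
  "of_int q * binom (Suc p) q = of_nat (Suc p) * binom p (q - 1)"
proof (cases "q \<le> 0")
  case True
  then show ?thesis by (cases "q = 0") (auto simp: binom_def)
next
  case False
  then obtain r where q: "q = int (Suc r)"
    by (metis not_le gr0_implies_Suc zero_less_imp_eq_int)
  have "(of_nat (Suc r * (Suc p choose Suc r)) :: rat) = of_nat (Suc p * (p choose r))"
    by (simp only: Suc_times_binomial)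
  then show ?thesis
    unfolding q by (simp add: binom_def nat_add_distrib algebra_simps del: binomial_Suc_Suc)
qed

section \<open>The shifted semi-Catalan triangle as a sequence of powers\<close>

lemma shifted_semi_catalan_ballot:
  "shifted_semi_catalan p q =
     binom (2 * p + 1) (int p - int q) - binom (2 * p + 1) (int p - int q - 1)"
proof -
  define r where "r = int p - int q"
  define a where "a = binom (2 * p + 2) r"
  have lower: "of_int r * a = (2 * of_nat p + 2) * binom (2 * p + 1) (r - 1)"
    using binom_absorption[of r "2 * p + 1"] by (simp add: a_def)
  have pascal: "a = binom (2 * p + 1) r + binom (2 * p + 1) (r - 1)"
    using binom_Suc[of "2 * p + 1" r] by (simp add: a_def)
  have r: "(of_int r :: rat) = of_nat p - of_nat q"
    by (simp add: r_def)
  have "(2 * of_nat p + 2) * (binom (2 * p + 1) r - binom (2 * p + 1) (r - 1))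
      = (2 * of_nat p + 2 - 2 * of_int r) * a"
    using lower pascal by (simp add: algebra_simps)
  also have "\<dots> = 2 * ((of_nat q + 1) * a)"
    unfolding r by (simp add: algebra_simps)
  finally have "(of_nat p + 1) * (binom (2 * p + 1) r - binom (2 * p + 1) (r - 1))
      = (of_nat q + 1) * a"
    by (simp add: algebra_simps)
  moreover have "(of_nat p + 1 :: rat) \<noteq> 0"
    by (metis of_nat_Suc of_nat_eq_0_iff add.commute nat.distinct(1))
  ultimately have "binom (2 * p + 1) r - binom (2 * p + 1) (r - 1)
      = (of_nat q + 1) / (of_nat p + 1) * a"
    by (simp add: field_simps)
  then show ?thesis
    by (simp add: shifted_semi_catalan_def a_def r_def)
qed

lemma shifted_semi_catalan_eq_0: "p < q \<Longrightarrow> shifted_semi_catalan p q = 0"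
  by (simp add: shifted_semi_catalan_def binom_neg)

lemma shifted_semi_catalan_0: "shifted_semi_catalan 0 q = of_bool (q = 0)"
  by (cases "q = 0") (simp_all add: shifted_semi_catalan_eq_0, simp add: shifted_semi_catalan_def)

lemma shifted_semi_catalan_Suc_Suc:
  "shifted_semi_catalan (Suc p) (Suc q) =
     shifted_semi_catalan p q + 2 * shifted_semi_catalan p (Suc q)
     + shifted_semi_catalan p (Suc (Suc q))"
proof -
  have shift: "2 * Suc p + 1 = Suc (Suc (2 * p + 1))"
    and lower: "int (Suc p) - int (Suc q) = int p - int q"
      "int p - int (Suc q) = int p - int q - 1"
      "int p - int (Suc (Suc q)) = int p - int q - 2"
    by simp_all
  show ?thesis
    unfolding shifted_semi_catalan_ballot shift lower binom_Suc_Suc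
    by (simp add: algebra_simps)
qed

text \<open>The same recurrence would give a further term with column index \<open>-1\<close>; it vanishes because
  the two middle binomial coefficients of an odd row agree.\<close>

lemma shifted_semi_catalan_Suc_0:
  "shifted_semi_catalan (Suc p) 0 = 2 * shifted_semi_catalan p 0 + shifted_semi_catalan p 1"
proof -
  have shift: "2 * Suc p + 1 = Suc (Suc (2 * p + 1))"
    and lower: "int (Suc p) - int 0 = int p + 1" "int p - int 0 = int p"
    by simp_all
  have "binom (2 * p + 1) (int p + 1) = binom (2 * p + 1) (int p)"
    using binom_symmetric[of "2 * p + 1" "int p"] by (simp add: algebra_simps)
  then show ?thesis
    unfolding shifted_semi_catalan_ballot shift lower binom_Suc_Suc
    by (simp add: algebra_simps)
qed

lemma catalan_eq_shifted_semi_catalan: "catalan (p + 1) = shifted_semi_catalan p 0"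
proof -
  have index: "2 * (p + 1) = Suc (2 * p + 1)" by simp
  have "binom (2 * p + 1) (int p + 2) = binom (2 * p + 1) (int p - 1)"
    using binom_symmetric[of "2 * p + 1" "int p - 1"] by (simp add: algebra_simps)
  then show ?thesis
    unfolding catalan_def shifted_semi_catalan_ballot index binom_Suc
    by (simp add: algebra_simps)
qed

section \<open>Inner products of rows\<close>

text \<open>The discrete Green identity for the tridiagonal operator: truncating the inner product
  after the column \<open>N\<close> leaves only a boundary term.\<close>

lemma shifted_semi_catalan_green:
  "(\<Sum>i\<le>N. shifted_semi_catalan (Suc j) i * shifted_semi_catalan k i
        - shifted_semi_catalan j i * shifted_semi_catalan (Suc k) i)
   = shifted_semi_catalan j (Suc N) * shifted_semi_catalan k N
     - shifted_semi_catalan j N * shifted_semi_catalan k (Suc N)"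
proof (induction N)
  case 0
  then show ?case by (simp add: shifted_semi_catalan_Suc_0 algebra_simps)
next
  case (Suc N)
  then show ?case by (simp add: shifted_semi_catalan_Suc_Suc algebra_simps)
qed

lemma sum_shifted_semi_catalan_swap:
  assumes "j \<le> N" "k \<le> N"
  shows "(\<Sum>i\<le>N. shifted_semi_catalan (Suc j) i * shifted_semi_catalan k i)
       = (\<Sum>i\<le>N. shifted_semi_catalan j i * shifted_semi_catalan (Suc k) i)"
  using shifted_semi_catalan_green[of j k N] assms
  by (simp add: sum_subtractf shifted_semi_catalan_eq_0)

lemma sum_shifted_semi_catalan_mult:
  assumes "j < n"
  shows "(\<Sum>i<n. shifted_semi_catalan j i * shifted_semi_catalan k i) = catalan (j + k + 1)"
proof -
  \<comment> \<open>Each swap raises the second row by one, so the boundary terms of all swaps vanish when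
    the sum reaches column \<open>j + k\<close>.\<close>
  have long: "(\<Sum>i\<le>N. shifted_semi_catalan j i * shifted_semi_catalan k i)
      = shifted_semi_catalan (j + k) 0" if "j + k \<le> N" for N
    using that
  proof (induction j arbitrary: k)
    case 0
    have "(\<Sum>i\<le>N. shifted_semi_catalan 0 i * shifted_semi_catalan k i)
        = (\<Sum>i\<le>N. if i = 0 then shifted_semi_catalan k 0 else 0)"
      by (intro sum.cong) (auto simp: shifted_semi_catalan_0)
    then show ?case by simp
  next
    case (Suc j)
    then show ?case
      using sum_shifted_semi_catalan_swap[of j N k] Suc.IH[of "Suc k"] by simp
  qed
  have "(\<Sum>i<n. shifted_semi_catalan j i * shifted_semi_catalan k i)
      = (\<Sum>i\<le>n + j + k. shifted_semi_catalan j i * shifted_semi_catalan k i)"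
    using assms by (intro sum.mono_neutral_left) (auto simp: shifted_semi_catalan_eq_0)
  then show ?thesis
    using long[of "n + j + k"] catalan_eq_shifted_semi_catalan[of "j + k"] by simp
qed

section \<open>Inverting the semi-Catalan triangle\<close>

text \<open>The coefficient of \<open>x\<^sup>k\<close> in the Chebyshev polynomial \<open>U\<^sub>j (x/2 - 1)\<close>.\<close>

definition chebyshev_coeff :: "nat \<Rightarrow> nat \<Rightarrow> rat" where
  "chebyshev_coeff j k = (-1) ^ (j + k) * binom (j + k + 1) (int j - int k)"

lemma chebyshev_coeff_eq_0: "j < k \<Longrightarrow> chebyshev_coeff j k = 0"
  by (simp add: chebyshev_coeff_def binom_neg)

lemma chebyshev_coeff_const: "chebyshev_coeff j 0 = (-1) ^ j * (of_nat j + 1)"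
  using binom_of_nat[of "j + 1" j] by (simp add: chebyshev_coeff_def)

lemma chebyshev_coeff_Suc_Suc_0:
  "chebyshev_coeff (Suc (Suc j)) 0 = - 2 * chebyshev_coeff (Suc j) 0 - chebyshev_coeff j 0"
  by (simp add: chebyshev_coeff_const algebra_simps)

lemma chebyshev_coeff_Suc_Suc_Suc:
  "chebyshev_coeff (Suc (Suc j)) (Suc k) =
     chebyshev_coeff (Suc j) k - 2 * chebyshev_coeff (Suc j) (Suc k) - chebyshev_coeff j (Suc k)"
proof -
  define N where "N = j + k + 2"
  define r where "r = int j + 1 - int k"
  have args: "Suc (Suc j) + Suc k + 1 = Suc (Suc N)" "Suc j + k + 1 = N"
      "Suc j + Suc k + 1 = Suc N" "j + Suc k + 1 = N"
      "int (Suc (Suc j)) - int (Suc k) = r" "int (Suc j) - int k = r"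
      "int (Suc j) - int (Suc k) = r - 1" "int j - int (Suc k) = r - 2"
    by (simp_all add: N_def r_def)
  show ?thesis
    unfolding chebyshev_coeff_def args binom_Suc_Suc binom_Suc
    by (simp add: algebra_simps)
qed

text \<open>In terms of the tridiagonal matrix \<open>A\<close> whose powers give the rows of the triangle, the left
  side is the \<open>i\<close>-th component of \<open>P\<^sub>j(A) e\<^sub>0\<close>. In the induction the recurrence of \<open>P\<close> turns into
  \<open>(A - 2) e\<^bsub>j+1\<^esub> - e\<^sub>j = e\<^bsub>j+2\<^esub>\<close>.\<close>

lemma sum_chebyshev_coeff_mult:
  assumes "j < n"
  shows "(\<Sum>k<n. chebyshev_coeff j k * shifted_semi_catalan k i) = of_bool (i = j)"
  using assms
proof (induction j arbitrary: n i rule: induct_nat_012)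
  case 0
  have "(\<Sum>k<n. chebyshev_coeff 0 k * shifted_semi_catalan k i)
      = (\<Sum>k<n. if k = 0 then shifted_semi_catalan 0 i else 0)"
    by (intro sum.cong) (auto simp: chebyshev_coeff_eq_0 chebyshev_coeff_const)
  then show ?case using 0 by (simp add: shifted_semi_catalan_0)
next
  case 1
  have "(\<Sum>k<n. chebyshev_coeff (Suc 0) k * shifted_semi_catalan k i)
      = (\<Sum>k\<in>{0, 1}. chebyshev_coeff (Suc 0) k * shifted_semi_catalan k i)"
    using 1 by (intro sum.mono_neutral_right) (auto simp: chebyshev_coeff_eq_0)
  also have "\<dots> = - 2 * shifted_semi_catalan 0 i + shifted_semi_catalan (Suc 0) i"
    by (simp add: chebyshev_coeff_const) (simp add: chebyshev_coeff_def)
  also have "\<dots> = of_bool (i = Suc 0)"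
    by (cases i)
      (auto simp: shifted_semi_catalan_Suc_0 shifted_semi_catalan_Suc_Suc shifted_semi_catalan_0)
  finally show ?case .
next
  case (ge2 j)
  then obtain m where n: "n = Suc m" and m: "Suc j < m" by (cases n) auto
  let ?c = chebyshev_coeff and ?s = shifted_semi_catalan
  have unit: "(\<Sum>k<m. ?c (Suc j) k * ?s k l) = of_bool (l = Suc j)" for l
    using ge2.IH(2)[of m l] m by simp
  \<comment> \<open>The factor \<open>x\<close> in the recurrence of the polynomials moves the sum to the next row.\<close>
  have "(\<Sum>k<n. ?c (Suc (Suc j)) k * ?s k i)
      = (\<Sum>k<m. ?c (Suc j) k * ?s (Suc k) i)
        - 2 * (\<Sum>k<n. ?c (Suc j) k * ?s k i) - (\<Sum>k<n. ?c j k * ?s k i)"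
    unfolding n sum.lessThan_Suc_shift
    by (simp add: chebyshev_coeff_Suc_Suc_0 chebyshev_coeff_Suc_Suc_Suc algebra_simps
          sum.distrib sum_subtractf sum_distrib_left)
  also have "\<dots> = (\<Sum>k<m. ?c (Suc j) k * ?s (Suc k) i) - 2 * of_bool (i = Suc j) - of_bool (i = j)"
    using ge2.IH(1)[of n i] ge2.IH(2)[of n i] ge2.prems by simp
  also have "(\<Sum>k<m. ?c (Suc j) k * ?s (Suc k) i)
      = of_bool (i = Suc (Suc j)) + 2 * of_bool (i = Suc j) + of_bool (i = j)"
  proof (cases i)
    case 0
    have "(\<Sum>k<m. ?c (Suc j) k * ?s (Suc k) 0)
        = 2 * (\<Sum>k<m. ?c (Suc j) k * ?s k 0) + (\<Sum>k<m. ?c (Suc j) k * ?s k 1)"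
      by (simp add: shifted_semi_catalan_Suc_0 algebra_simps sum.distrib sum_distrib_left)
    then show ?thesis unfolding 0 unit by auto
  next
    case (Suc l)
    have "(\<Sum>k<m. ?c (Suc j) k * ?s (Suc k) (Suc l))
        = (\<Sum>k<m. ?c (Suc j) k * ?s k l) + 2 * (\<Sum>k<m. ?c (Suc j) k * ?s k (Suc l))
          + (\<Sum>k<m. ?c (Suc j) k * ?s k (Suc (Suc l)))"
      by (simp add: shifted_semi_catalan_Suc_Suc algebra_simps sum.distrib sum_distrib_left)
    then show ?thesis unfolding Suc unit by auto
  qed
  finally show ?case by simp
qed

section \<open>The matrix inverses\<close>

lemma mat_inverse_eq_Some:
  fixes A :: "'a :: field mat"
  assumes A: "A \<in> carrier_mat n n" and B: "B \<in> carrier_mat n n" and BA: "B * A = 1\<^sub>m n"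
  shows "mat_inverse A = Some B"
proof (cases "mat_inverse A")
  case None
  have "A * B = 1\<^sub>m n" by (rule mat_mult_left_right_inverse[OF B A BA])
  then have "A \<in> Units (ring_mat TYPE('a) n ())"
    using A B BA by (auto simp: Units_def ring_mat_def)
  then show ?thesis using mat_inverse(1)[OF A None, of "()"] by blast
next
  case (Some D)
  then have D: "A * D = 1\<^sub>m n" "D \<in> carrier_mat n n" using mat_inverse(2)[OF A] by auto
  have "B = B * (A * D)" using B D(1) by simp
  also have "\<dots> = (B * A) * D" using A B D(2) by (simp add: assoc_mult_mat)
  also have "\<dots> = D" using BA D(2) by simp
  finally show ?thesis using Some by simp
qed

theorem corollary7p4:
  fixes n :: nat
  assumes "n \<ge> 1"
  shows "mat_inverse (shifted_semi_catalan_mat n) =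
           Some (mat n n (\<lambda>(j, k). (-1) ^ (j + k) * binom (j + k + 1) (int j - int k))) \<and>
         mat_inverse (shifted_catalan_mat n) =
           Some (mat n n (\<lambda>(j, k). (-1) ^ (j + k) *
             (\<Sum>i = max j k..n - 1.
                binom (i + j + 1) (int i - int j) * binom (i + k + 1) (int i - int k))))"
proof -
  define S where "S = shifted_semi_catalan_mat n"
  define B where "B = mat n n (\<lambda>(j, k). chebyshev_coeff j k)"
  have S: "S \<in> carrier_mat n n" and B: "B \<in> carrier_mat n n"
    by (simp_all add: S_def shifted_semi_catalan_mat_def B_def)
  have ST: "S\<^sup>T \<in> carrier_mat n n" and BT: "B\<^sup>T \<in> carrier_mat n n" using S B by simp_all
  have BS: "B * S = 1\<^sub>m n"
    by (rule eq_matI)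
      (auto simp: S_def B_def shifted_semi_catalan_mat_def scalar_prod_def atLeast0LessThan
        sum_chebyshev_coeff_mult)
  have C: "shifted_catalan_mat n = S * S\<^sup>T"
    by (rule eq_matI)
      (auto simp: S_def shifted_catalan_mat_def shifted_semi_catalan_mat_def scalar_prod_def
        atLeast0LessThan sum_shifted_semi_catalan_mult)
  have "B\<^sup>T * S\<^sup>T = (S * B)\<^sup>T" by (simp add: transpose_mult[OF S B])
  also have "S * B = 1\<^sub>m n" by (rule mat_mult_left_right_inverse[OF B S BS])
  finally have BTST: "B\<^sup>T * S\<^sup>T = 1\<^sub>m n" by simp
  have "(B\<^sup>T * B) * (S * S\<^sup>T) = B\<^sup>T * ((B * S) * S\<^sup>T)"
    using B S BT ST by (simp add: assoc_mult_mat[of _ n n _ n _ n])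
  also have "\<dots> = 1\<^sub>m n" using BS BTST ST by simp
  finally have "mat_inverse (shifted_catalan_mat n) = Some (B\<^sup>T * B)"
    unfolding C using B S by (intro mat_inverse_eq_Some[of _ n]) simp_all
  moreover have "B\<^sup>T * B = mat n n (\<lambda>(j, k). (-1) ^ (j + k) *
             (\<Sum>i = max j k..n - 1.
                binom (i + j + 1) (int i - int j) * binom (i + k + 1) (int i - int k)))"
  proof (rule eq_matI, goal_cases)
    case (1 j k)
    then have jk: "j < n" "k < n" by simp_all
    have "(B\<^sup>T * B) $$ (j, k) = (\<Sum>i<n. chebyshev_coeff i j * chebyshev_coeff i k)"
      using jk by (simp add: B_def scalar_prod_def atLeast0LessThan)
    also have "\<dots> = (\<Sum>i = max j k..n - 1. chebyshev_coeff i j * chebyshev_coeff i k)"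
      using jk by (intro sum.mono_neutral_right) (auto simp: chebyshev_coeff_eq_0 not_le)
    also have "\<dots> = (\<Sum>i = max j k..n - 1. (-1) ^ (j + k) *
        (binom (i + j + 1) (int i - int j) * binom (i + k + 1) (int i - int k)))"
      by (intro sum.cong refl)
        (simp add: chebyshev_coeff_def power_add mult_ac flip: power_mult_distrib)
    finally show ?case using jk by (simp add: sum_distrib_left)
  qed (simp_all add: B_def)
  moreover have "mat_inverse S = Some B" by (rule mat_inverse_eq_Some[OF S B BS])
  ultimately show ?thesis
    by (simp add: S_def B_def chebyshev_coeff_def)
qed

end
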